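(* Let $n,d\ge 1$. Let $V$ be a random $n\times d$ real matrix with rows $V_1,\dots,V_n\in\mathbb{R}^d$, almost surely nonzero, let $$D=\mathrm{diag}\Big(\tfrac{1}{\|V_1\|_2},\dots,\tfrac{1}{\|V_n\|_2}\Big),$$ and put $\tilde V=DV$, with rows $\tilde V_i=V_i/\|V_i\|_2$. Suppose that the exogenous variables $\tilde V_1,\dots,\tilde V_n$ are mutually independent and have equal variances, i.e. there is $\sigma^2>0$ with $\mathrm{var}(\tilde V_i)=\sigma^2$ for all $i$. Let $B\in\mathbb{R}^{n\times n}$ be a matrix whose directed graph $\mathcal{G}(B)$ is acyclic, and let $P(Z)$ be the law of the random $n\times d$ matrix $Z$ generated from $$Z=BZ+DV .$$ Then the graph $\mathcal{G}(B)$ is uniquely identifiable from $P(Z)$: if $(B',V')$ is another pair satisfying the same conditions (with the same $n$ and $d$, with $D'$ defined from $V'$ as $D$ is from $V$, and with a possibly different common variance $\sigma'^2>0$), $Z'$ is generated from $Z'=B'Z'+D'V'$, and $P(Z')=P(Z)$, then $\mathcal{G}(B')=\mathcal{G}(B)$.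
   Context: For a matrix $B=(\beta_{j,k})\in\mathbb{R}^{n\times n}$, $\mathcal{G}(B)$ denotes the directed graph with vertex set $\{1,\dots,n\}$ and edge set $E(B)=\{(k,j):\beta_{j,k}\neq 0\}$, where $(k,j)$ is a directed edge from $k$ to $j$ (self-loops count as cycles). If $\mathcal{G}(B)$ is acyclic then $I-B$ is invertible, so the equation $Z=BZ+DV$ determines $Z=(I-B)^{-1}DV$. Here $\|\cdot\|_2$ is the Euclidean norm on $\mathbb{R}^d$. For a square-integrable random vector $W$ in $\mathbb{R}^d$, $\mathrm{var}(W)=\mathbb{E}\|W-\mathbb{E}W\|_2^2$ (the usual variance when $d=1$). The model $Z=BZ+\tilde V$ is a linear structural equation model with nodes given by the rows $Z_1,\dots,Z_n$ of $Z$ and exogenous variables given by the rows of $\tilde V$. *)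

theory Defs
  imports "HOL-Probability.Probability"
begin

text \<open>A random \<open>n \<times> d\<close> matrix is a measurable function into \<^typ>\<open>real^'d^'n\<close>; its rows are indexed
  by the finite type \<^typ>\<open>'n\<close>, which is also the vertex set of the graphs below.\<close>

text \<open>As all the graphs share the vertex set \<^typ>\<open>'n\<close>, a graph is represented by its edge relation.
  Note the transposition: the entry in row \<open>j\<close> and column \<open>k\<close> gives the edge from \<open>k\<close> to \<open>j\<close>.\<close>

definition sem_graph :: "real^'n^'n \<Rightarrow> ('n \<times> 'n) set" where
  "sem_graph B = {(k, j). B $ j $ k \<noteq> 0}"

definition row_scaling :: "real^'d^'n \<Rightarrow> real^'n^'n" where
  "row_scaling A = (\<chi> i j. if i = j then 1 / norm (row i A) else 0)"

definition row_normalize :: "real^'d^'n \<Rightarrow> real^'d^'n" where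
  "row_normalize A = row_scaling A ** A"

definition vec_variance :: "'w measure \<Rightarrow> ('w \<Rightarrow> real^'d) \<Rightarrow> real" where
  "vec_variance M W =
     (LINT w|M. (norm (W w - (LINT w'|M. W w')))\<^sup>2)"

text \<open>The conditions on a pair \<open>(B, V)\<close>, where \<open>V\<close> lives on the sample space \<open>M\<close>.\<close>

definition normalized_sem ::
    "'w measure \<Rightarrow> real^'n^'n \<Rightarrow> ('w \<Rightarrow> real^'d^'n) \<Rightarrow> bool" where
  "normalized_sem M B V \<longleftrightarrow>
     prob_space M \<and>
     V \<in> borel_measurable M \<and>
     (AE w in M. \<forall>i. row i (V w) \<noteq> 0) \<and>
     prob_space.indep_vars M (\<lambda>_. borel) (\<lambda>i w. row i (row_normalize (V w))) UNIV \<and>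
     (\<exists>\<sigma>. \<sigma>\<^sup>2 > 0 \<and> (\<forall>i. vec_variance M (\<lambda>w. row i (row_normalize (V w))) = \<sigma>\<^sup>2)) \<and>
     acyclic (sem_graph B)"

definition generated_by ::
    "'w measure \<Rightarrow> real^'n^'n \<Rightarrow> ('w \<Rightarrow> real^'d^'n) \<Rightarrow> ('w \<Rightarrow> real^'d^'n) \<Rightarrow> bool" where
  "generated_by M B V Z \<longleftrightarrow>
     Z \<in> borel_measurable M \<and>
     (AE w in M. Z w = B ** Z w + row_scaling (V w) ** V w)"

end

theory Submission
  imports Defs
begin

text \<open>Write \<open>A = I - B\<close>. Since the rows of \<open>DV\<close> are bounded, \<open>Z\<close> has second moments, and the centred
  Gram matrix \<open>\<Sigma>\<close> of its rows satisfies \<open>A \<Sigma> A\<^sup>T = \<sigma>\<^sup>2 I\<close>; hence \<open>A\<^sup>T A / \<sigma>\<^sup>2\<close> is the inverse of \<open>\<Sigma>\<close> and is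
  determined by the law of \<open>Z\<close>. The diagonal entries of \<open>A\<^sup>T A\<close> are \<open>1 + (\<Sum>\<^sub>j \<beta>\<^sub>j\<^sub>k\<^sup>2)\<close>, so their minimum is
  \<open>1\<close>, attained exactly at the sinks of the graph. This fixes \<open>\<sigma>\<^sup>2\<close> and the sinks. Column \<open>s\<close> of \<open>A\<close> for a
  sink \<open>s\<close> is a unit vector, so row \<open>s\<close> of \<open>A\<close> equals row \<open>s\<close> of \<open>A\<^sup>T A\<close>; deleting \<open>s\<close> and inducting
  recovers \<open>B\<close>.\<close>

section \<open>Acyclic matrices\<close>

text \<open>On a finite vertex set the converse edge relation is well-founded, and a minimal element
  of \<open>S\<close> has no edge into \<open>S\<close>. Working relative to \<open>S\<close> allows
  sinks to be deleted one after another.\<close>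

lemma acyclic_sem_graph_sink:
  fixes B :: "real^'n^'n"
  assumes "acyclic (sem_graph B)" and "S \<noteq> {}"
  obtains s where "s \<in> S" and "\<And>j. j \<in> S \<Longrightarrow> B $ j $ s = 0"
proof -
  have "wf ((sem_graph B)\<inverse>)"
    using assms(1) by (intro finite_acyclic_wf_converse) auto
  then obtain s where "s \<in> S" "\<And>y. (y, s) \<in> (sem_graph B)\<inverse> \<Longrightarrow> y \<notin> S"
    using assms(2) by (meson ex_in_conv wfE_min)
  then show ?thesis
    by (intro that[of s]) (auto simp: sem_graph_def)
qed

lemma acyclic_sem_graph_diagonal:
  assumes "acyclic (sem_graph B)"
  shows "B $ i $ i = 0"
  using assms by (force simp: acyclic_def sem_graph_def)

text \<open>A kernel vector solves \<open>x = B *v x\<close>, so each coordinate is a combination of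
  the coordinates at its parents, and induction along the edges makes all of them vanish. The
  inverse serves to bound \<open>Z\<close> by the noise.\<close>

lemma acyclic_imp_left_inverse:
  fixes B :: "real^'n^'n"
  assumes "acyclic (sem_graph B)"
  obtains C where "C ** (mat 1 - B) = mat 1"
proof -
  have "x = 0" if x: "(mat 1 - B) *v x = 0" for x
  proof -
    have eq: "x $ j = (\<Sum>k\<in>UNIV. B $ j $ k * x $ k)" for j
    proof -
      have "((mat 1 - B) *v x) $ j = x $ j - (B *v x) $ j"
        by (simp add: matrix_vector_mult_diff_rdistrib)
      then have "x $ j = (B *v x) $ j"
        using x by simp
      then show ?thesis
        by (simp add: matrix_vector_mult_def)
    qed
    have "wf (sem_graph B)"
      using assms by (intro finite_acyclic_wf) auto
    then have "x $ j = 0" for j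
    proof (induction j rule: wf_induct_rule)
      case (less j)
      have "B $ j $ k * x $ k = 0" for k
        using less[of k] by (auto simp: sem_graph_def)
      then have "(\<Sum>k\<in>UNIV. B $ j $ k * x $ k) = 0"
        by (intro sum.neutral) blast
      then show ?case
        by (simp add: eq[of j])
    qed
    then show ?thesis
      by (simp add: vec_eq_iff)
  qed
  then show ?thesis
    using that matrix_left_invertible_ker[of "mat 1 - B"] by blast
qed

section \<open>Recovering an acyclic matrix from its Gram matrix\<close>

lemma gram_column_sink:
  fixes B :: "real^'n^'n" and S :: "'n set"
  assumes "s \<in> S" and "\<And>j. j \<in> S \<Longrightarrow> B $ j $ s = 0"
  shows "(\<Sum>j\<in>S. (mat 1 - B) $ j $ s * (mat 1 - B) $ j $ k) = (mat 1 - B) $ s $ k"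
proof -
  have "(\<Sum>j\<in>S. (mat 1 - B) $ j $ s * (mat 1 - B) $ j $ k)
      = (\<Sum>j\<in>S. if j = s then (mat 1 - B) $ j $ k else 0)"
    using assms(2) by (intro sum.cong) (auto simp: mat_def)
  then show ?thesis
    using assms(1) by simp
qed

text \<open>Acyclicity excludes self-loops, so the diagonal of \<open>mat 1 - B\<close> is 1 and the
  squares of the entries of \<open>B\<close> enter without a cross term.\<close>

lemma gram_diagonal:
  fixes B :: "real^'n^'n" and S :: "'n set"
  assumes "acyclic (sem_graph B)" and "s \<in> S"
  shows "(\<Sum>j\<in>S. (mat 1 - B) $ j $ s * (mat 1 - B) $ j $ s) = 1 + (\<Sum>j\<in>S. (B $ j $ s)\<^sup>2)"
proof -
  have "(\<Sum>j\<in>S. (mat 1 - B) $ j $ s * (mat 1 - B) $ j $ s)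
      = (\<Sum>j\<in>S. (if j = s then 1 else 0) + (B $ j $ s)\<^sup>2)"
    using acyclic_sem_graph_diagonal[OF assms(1)]
    by (intro sum.cong) (auto simp: mat_def power2_eq_square)
  then show ?thesis
    using assms(2) by (simp add: sum.distrib)
qed

text \<open>The sums over \<open>S\<close> form the Gram matrix of the submatrix with rows and
  columns in \<open>S\<close>; restricting the rows as well keeps the hypothesis stable under
  deletion of a sink.\<close>

lemma acyclic_gram_inject_on:
  fixes B B' :: "real^'n^'n" and S :: "'n set"
  assumes B: "acyclic (sem_graph B)" and B': "acyclic (sem_graph B')"
    and gram: "\<And>k l. k \<in> S \<Longrightarrow> l \<in> S \<Longrightarrow>
      (\<Sum>j\<in>S. (mat 1 - B) $ j $ k * (mat 1 - B) $ j $ l)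
      = (\<Sum>j\<in>S. (mat 1 - B') $ j $ k * (mat 1 - B') $ j $ l)"
    and "j \<in> S" "k \<in> S"
  shows "B $ j $ k = B' $ j $ k"
  using finite[of S] gram \<open>j \<in> S\<close> \<open>k \<in> S\<close>
proof (induction S arbitrary: j k rule: finite_psubset_induct)
  case (psubset S)
  obtain s where s: "s \<in> S" "\<And>j. j \<in> S \<Longrightarrow> B $ j $ s = 0"
    using acyclic_sem_graph_sink[OF B, of S] psubset.prems(2) by auto
  \<comment> \<open>The diagonal Gram entry detects sinks: its excess over 1 is a sum of squares, so
    a sink of one graph on \<open>S\<close> is a sink of the other.\<close>
  have "(\<Sum>j\<in>S. (B' $ j $ s)\<^sup>2) = (\<Sum>j\<in>S. (B $ j $ s)\<^sup>2)"
    using gram_diagonal[OF B s(1)] gram_diagonal[OF B' s(1)] psubset.prems(1)[OF s(1) s(1)]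
    by simp
  also have "\<dots> = 0"
    using s(2) by simp
  finally have s': "B' $ j $ s = 0" if "j \<in> S" for j
    using that by (simp add: sum_nonneg_eq_0_iff)
  have row: "(mat 1 - B) $ s $ k = (mat 1 - B') $ s $ k" if "k \<in> S" for k
    using psubset.prems(1)[OF s(1) that] gram_column_sink[of s S B k, OF s]
      gram_column_sink[of s S B' k, OF s(1) s'] by simp
  have IH: "B $ j $ k = B' $ j $ k" if "j \<in> S - {s}" "k \<in> S - {s}" for j k
  proof (rule psubset.IH[OF _ _ that])
    show "S - {s} \<subset> S"
      using s(1) by blast
    fix k l assume kl: "k \<in> S - {s}" "l \<in> S - {s}"
    show "(\<Sum>j\<in>S - {s}. (mat 1 - B) $ j $ k * (mat 1 - B) $ j $ l)
      = (\<Sum>j\<in>S - {s}. (mat 1 - B') $ j $ k * (mat 1 - B') $ j $ l)"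
      \<comment> \<open>Row \<open>s\<close> contributes the same product to both Gram entries, so
        it can be subtracted from both sides.\<close>
      using psubset.prems(1)[of k l] kl s(1) row[of k] row[of l]
      by (simp add: sum.remove[of S s])
  qed
  show ?case
  proof (cases "j = s \<or> k = s")
    case True
    then show ?thesis
      using row[OF psubset.prems(3)] s(2) s' psubset.prems(2) by auto
  next
    case False
    then show ?thesis
      using IH psubset.prems by simp
  qed
qed

text \<open>Compare the diagonal entries at a sink of \<open>B'\<close>: the right one is exactly
  \<open>t'\<close>, the left one at least \<open>t\<close>. Applied in both directions, this
  equates the scales.\<close>

lemma acyclic_gram_scale_le:
  fixes B B' :: "real^'n^'n"
  assumes B: "acyclic (sem_graph B)" and B': "acyclic (sem_graph B')"
    and t: "t > 0"
    and eq: "t *\<^sub>R (transpose (mat 1 - B) ** (mat 1 - B))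
      = t' *\<^sub>R (transpose (mat 1 - B') ** (mat 1 - B'))"
  shows "t \<le> t'"
proof -
  obtain s where s: "\<And>j. B' $ j $ s = 0"
    using acyclic_sem_graph_sink[OF B', of UNIV] by auto
  have "t * (1 + (\<Sum>j\<in>UNIV. (B $ j $ s)\<^sup>2)) = t' * (1 + (\<Sum>j\<in>UNIV. (B' $ j $ s)\<^sup>2))"
    using arg_cong[OF eq, of "\<lambda>X. X $ s $ s"] gram_diagonal[OF B, of s UNIV]
      gram_diagonal[OF B', of s UNIV]
    by (simp add: matrix_matrix_mult_def transpose_def)
  moreover have "t * 1 \<le> t * (1 + (\<Sum>j\<in>UNIV. (B $ j $ s)\<^sup>2))"
    using t by (intro mult_left_mono) (auto intro: sum_nonneg)
  ultimately show ?thesis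
    using s by simp
qed

lemma acyclic_gram_inject:
  fixes B B' :: "real^'n^'n"
  assumes B: "acyclic (sem_graph B)" and B': "acyclic (sem_graph B')"
    and t: "t > 0" "t' > 0"
    and eq: "t *\<^sub>R (transpose (mat 1 - B) ** (mat 1 - B))
      = t' *\<^sub>R (transpose (mat 1 - B') ** (mat 1 - B'))"
  shows "B = B'"
proof -
  have "t = t'"
    using acyclic_gram_scale_le[OF B B' t(1) eq] acyclic_gram_scale_le[OF B' B t(2) eq[symmetric]]
    by simp
  then have gram: "transpose (mat 1 - B) ** (mat 1 - B) = transpose (mat 1 - B') ** (mat 1 - B')"
    using eq t by simp
  have "B $ j $ k = B' $ j $ k" for j k
  proof (rule acyclic_gram_inject_on[OF B B', of UNIV])
    fix k l
    show "(\<Sum>j\<in>UNIV. (mat 1 - B) $ j $ k * (mat 1 - B) $ j $ l)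
      = (\<Sum>j\<in>UNIV. (mat 1 - B') $ j $ k * (mat 1 - B') $ j $ l)"
      using arg_cong[OF gram, of "\<lambda>X. X $ k $ l"]
      by (simp add: matrix_matrix_mult_def transpose_def)
  qed auto
  then show ?thesis
    by (simp add: vec_eq_iff)
qed

section \<open>The second moments of the model\<close>

lemma row_eq_nth: "row i A = A $ i"
  by (simp add: row_def vec_eq_iff)

lemma matrix_mult_nth_eq_sum:
  fixes A :: "real^'n^'m" and X :: "real^'d^'n"
  shows "(A ** X) $ i = (\<Sum>j\<in>UNIV. A $ i $ j *\<^sub>R X $ j)"
  by (simp add: vec_eq_iff matrix_matrix_mult_def)

text \<open>Since \<open>1 / 0 = 0\<close>, a zero row stays zero, so the bound holds at every
  matrix; it is the source of all integrability below.\<close>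

lemma norm_row_normalize_le: "norm (row i (row_normalize A)) \<le> 1"
proof -
  have "row i (row_normalize A) = (\<Sum>j\<in>UNIV. (if j = i then (1 / norm (A $ i)) *\<^sub>R A $ i else 0))"
    unfolding row_eq_nth row_normalize_def matrix_mult_nth_eq_sum
    by (intro sum.cong) (auto simp: row_scaling_def row_eq_nth)
  then show ?thesis
    by simp
qed

lemma (in prob_space) indep_vars_imp_indep_var:
  assumes "indep_vars N X I" and "i \<in> I" "j \<in> I" "i \<noteq> j"
  shows "indep_var (N i) (X i) (N j) (X j)"
proof -
  have "indep_var (PiM {i} N) (\<lambda>w. restrict (\<lambda>k. X k w) {i}) (PiM {j} N) (\<lambda>w. restrict (\<lambda>k. X k w) {j})"
    using assms by (intro indep_var_restrict[OF assms(1)]) auto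
  from indep_var_compose[OF this, of "\<lambda>f. f i" "N i" "\<lambda>f. f j" "N j"] show ?thesis
    by (simp add: comp_def measurable_component_singleton)
qed

text \<open>Expand the inner product in the standard basis; each summand is a product of independent
  real variables, whose expectation factors.\<close>

lemma (in prob_space) indep_var_expectation_inner:
  fixes X Y :: "'a \<Rightarrow> 'b::euclidean_space"
  assumes indep: "indep_var borel X borel Y" and X: "integrable M X" and Y: "integrable M Y"
  shows "expectation (\<lambda>w. X w \<bullet> Y w) = expectation X \<bullet> expectation Y"
proof -
  have ind: "indep_var borel (\<lambda>w. X w \<bullet> b) borel (\<lambda>w. Y w \<bullet> b)" for b
    using indep_var_compose[OF indep, of "\<lambda>x. x \<bullet> b" borel "\<lambda>x. x \<bullet> b" borel]
    by (simp add: comp_def)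
  have int: "integrable M (\<lambda>w. (X w \<bullet> b) * (Y w \<bullet> b))" for b
    using ind X Y by (intro indep_var_integrable) auto
  have E: "expectation (\<lambda>w. (X w \<bullet> b) * (Y w \<bullet> b)) = (expectation X \<bullet> b) * (expectation Y \<bullet> b)" for b
    using ind[of b] X Y by (subst indep_var_lebesgue_integral) auto
  show ?thesis
    by (subst (1 2) euclidean_inner) (use int E in simp)
qed

text \<open>Each entry is the trace of the cross-covariance of two rows, which reduces vector-valued
  nodes to one real matrix. Taking the law as argument makes it common to two models with the same
  law.\<close>

definition row_covariance :: "(real^'d^'n) measure \<Rightarrow> real^'n^'n" where
  "row_covariance P =
     (\<chi> j k. LINT z|P. (row j z - (LINT y|P. row j y)) \<bullet> (row k z - (LINT y|P. row k y)))"

lemma row_covariance_distr: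
  fixes Z :: "'w \<Rightarrow> real^'d^'n"
  assumes [measurable]: "Z \<in> borel_measurable M"
  shows "row_covariance (distr M borel Z) $ j $ k =
    (LINT w|M. (Z w $ j - (LINT w'|M. Z w' $ j)) \<bullet> (Z w $ k - (LINT w'|M. Z w' $ k)))"
proof -
  have [measurable]: "(\<lambda>z::real^'d^'n. z $ j) \<in> borel_measurable borel" for j
    by (intro borel_measurable_continuous_onI continuous_intros)
  show ?thesis
    by (simp add: row_covariance_def row_eq_nth integral_distr)
qed

lemma sem_row_covariance:
  fixes B :: "real^'n^'n" and V Z :: "'w \<Rightarrow> real^'d^'n"
  assumes sem: "normalized_sem M B V" and gen: "generated_by M B V Z"
  obtains s where "s > 0"
    and "(mat 1 - B) ** row_covariance (distr M borel Z) ** transpose (mat 1 - B) = s *\<^sub>R mat 1"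
proof -
  define A where "A = mat 1 - B"
  define U where "U i w = row i (row_normalize (V w))" for i w
  interpret prob_space M
    using sem by (simp add: normalized_sem_def)
  have indep: "indep_vars (\<lambda>_. borel) U UNIV"
    using sem by (simp add: normalized_sem_def U_def[abs_def])
  obtain \<sigma> :: real where \<sigma>: "\<sigma>\<^sup>2 > 0" "\<And>i. vec_variance M (U i) = \<sigma>\<^sup>2"
    using sem by (auto simp: normalized_sem_def U_def[abs_def])
  have Z [measurable]: "Z \<in> borel_measurable M"
    using gen by (simp add: generated_by_def)
  have nth [measurable]: "(\<lambda>z::real^'d^'n. z $ j) \<in> borel_measurable borel" for j
    by (intro borel_measurable_continuous_onI continuous_intros)
  have U_meas [measurable]: "U i \<in> borel_measurable M" for i
    using indep by (auto simp: indep_vars_def)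
  have U_bound: "norm (U i w) \<le> 1" for i w
    by (simp add: U_def norm_row_normalize_le)
  have U_int [simp]: "integrable M (U i)" for i
    by (rule integrable_const_bound[where B = 1]) (auto simp: U_bound)
  obtain C where C: "C ** A = mat 1"
    using acyclic_imp_left_inverse[of B] sem by (auto simp: A_def normalized_sem_def)
  have AZ: "AE w in M. A ** Z w = row_normalize (V w)"
  proof -
    have "AE w in M. Z w = B ** Z w + row_normalize (V w)"
      using gen by (simp add: generated_by_def row_normalize_def)
    then show ?thesis
    proof eventually_elim
      case (elim w)
      have "A ** Z w = Z w - B ** Z w"
        by (simp add: A_def matrix_mult_nth_eq_sum vec_eq_iff mat_def left_diff_distrib sum_subtractf
            if_distrib[of "\<lambda>c. c * _"] cong: if_cong)
      then show ?case
        using elim by (metis add_diff_cancel_left')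
    qed
  qed
  have U_eq: "AE w in M. \<forall>i. (\<Sum>j\<in>UNIV. A $ i $ j *\<^sub>R Z w $ j) = U i w"
    using AZ by eventually_elim (simp add: U_def row_eq_nth flip: matrix_mult_nth_eq_sum)
  \<comment> \<open>Inverting the model writes row \<open>j\<close> of \<open>Z\<close> as a
    combination of noise rows of norm at most 1, with coefficients from row \<open>j\<close> of
    \<open>C\<close>.\<close>
  have Z_bound: "AE w in M. norm (Z w $ j) \<le> (\<Sum>i\<in>UNIV. \<bar>C $ j $ i\<bar>)" for j
    using AZ
  proof eventually_elim
    case (elim w)
    have "Z w = C ** row_normalize (V w)"
      using C elim by (metis matrix_mul_assoc matrix_mul_lid)
    then have "Z w $ j = (\<Sum>i\<in>UNIV. C $ j $ i *\<^sub>R U i w)"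
      by (simp add: matrix_mult_nth_eq_sum U_def row_eq_nth)
    also have "norm \<dots> \<le> (\<Sum>i\<in>UNIV. \<bar>C $ j $ i\<bar>)"
      using mult_left_mono[OF U_bound abs_ge_zero] by (intro sum_norm_le) auto
    finally show ?case .
  qed
  have Z_int [simp]: "integrable M (\<lambda>w. Z w $ j)" for j
    by (rule integrable_const_bound[OF Z_bound]) measurable
  define Y where "Y j w = Z w $ j - (LINT w'|M. Z w' $ j)" for j w
  have Y_meas [measurable]: "Y j \<in> borel_measurable M" for j
    unfolding Y_def by measurable
  obtain K where K: "\<And>j. AE w in M. norm (Y j w) \<le> K j"
  proof
    fix j
    show "AE w in M. norm (Y j w) \<le> (\<Sum>i\<in>UNIV. \<bar>C $ j $ i\<bar>) + norm (LINT w'|M. Z w' $ j)"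
      using Z_bound[of j] by eventually_elim (auto simp: Y_def intro: norm_triangle_le_diff)
  qed
  have YY_int [simp]: "integrable M (\<lambda>w. Y j w \<bullet> Y k w)" for j k
  proof (rule integrable_const_bound)
    show "AE w in M. norm (Y j w \<bullet> Y k w) \<le> K j * K k"
      using K[of j] K[of k]
    proof eventually_elim
      case (elim w)
      have "norm (Y j w \<bullet> Y k w) \<le> norm (Y j w) * norm (Y k w)"
        by (simp add: Cauchy_Schwarz_ineq2)
      also have "\<dots> \<le> K j * K k"
        using elim by (intro mult_mono) (auto intro: order_trans[OF norm_ge_zero])
      finally show ?case .
    qed
  qed measurable
  define X where "X i w = U i w - expectation (U i)" for i w
  have X_int [simp]: "integrable M (X i)" for i
    unfolding X_def by simp
  have X_0: "expectation (X i) = 0" for i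
    unfolding X_def by (simp add: prob_space)
  \<comment> \<open>Taking means in the structural equations shows that centring commutes with
    \<open>A\<close>, so the centred noise \<open>X\<close> is \<open>A\<close> applied to the
    centred rows \<open>Y\<close>.\<close>
  have EU: "expectation (U i) = (\<Sum>j\<in>UNIV. A $ i $ j *\<^sub>R (LINT w|M. Z w $ j))" for i
  proof -
    have "expectation (U i) = (LINT w|M. (\<Sum>j\<in>UNIV. A $ i $ j *\<^sub>R Z w $ j))"
      using U_eq by (intro integral_cong_AE) auto
    then show ?thesis
      by simp
  qed
  have X_eq: "AE w in M. \<forall>i. X i w = (\<Sum>j\<in>UNIV. A $ i $ j *\<^sub>R Y j w)"
    using U_eq
    by eventually_elim (simp add: X_def Y_def EU scaleR_diff_right sum_subtractf)
  \<comment> \<open>The diagonal is the common variance; off the diagonal, independence factors the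
    expectation into means, which are zero.\<close>
  have X_inner: "expectation (\<lambda>w. X i w \<bullet> X l w) = (if i = l then \<sigma>\<^sup>2 else 0)" for i l
  proof (cases "i = l")
    case True
    then show ?thesis
      using \<sigma>(2)[of l] by (simp add: vec_variance_def X_def power2_norm_eq_inner)
  next
    case False
    have "indep_var borel (U i) borel (U l)"
      using indep_vars_imp_indep_var[OF indep _ _ False] by simp
    from indep_var_compose[OF this, of "\<lambda>x. x - expectation (U i)" borel
        "\<lambda>x. x - expectation (U l)" borel]
    have "indep_var borel (X i) borel (X l)"
      by (simp add: comp_def X_def[abs_def])
    then show ?thesis
      using False by (simp add: indep_var_expectation_inner X_0)
  qed
  define S where "S = row_covariance (distr M borel Z)"
  have S: "S $ j $ k = expectation (\<lambda>w. Y j w \<bullet> Y k w)" for j k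
    by (simp add: S_def row_covariance_distr Y_def)
  have "(A ** S ** transpose A) $ i $ l = (\<sigma>\<^sup>2 *\<^sub>R mat 1 :: real^'n^'n) $ i $ l" for i l
  proof -
    have "(A ** S ** transpose A) $ i $ l
        = (\<Sum>k\<in>UNIV. \<Sum>j\<in>UNIV. A $ i $ j * A $ l $ k * expectation (\<lambda>w. Y j w \<bullet> Y k w))"
      by (simp add: matrix_matrix_mult_def transpose_def S sum_distrib_left sum_distrib_right ac_simps)
    also have "\<dots> = expectation (\<lambda>w. \<Sum>k\<in>UNIV. \<Sum>j\<in>UNIV. A $ i $ j * A $ l $ k * (Y j w \<bullet> Y k w))"
      by simp
    also have "\<dots> = expectation (\<lambda>w. X i w \<bullet> X l w)"
    proof (rule integral_cong_AE)
      show "(\<lambda>w. X i w \<bullet> X l w) \<in> borel_measurable M"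
        by (intro borel_measurable_inner borel_measurable_integrable X_int)
      show "AE w in M. (\<Sum>k\<in>UNIV. \<Sum>j\<in>UNIV. A $ i $ j * A $ l $ k * (Y j w \<bullet> Y k w)) = X i w \<bullet> X l w"
        using X_eq
        by eventually_elim
          (simp add: inner_sum_left inner_sum_right sum_distrib_left ac_simps)
    qed measurable
    finally show ?thesis
      by (simp add: X_inner mat_def)
  qed
  then show ?thesis
    using \<sigma>(1) by (intro that[of "\<sigma>\<^sup>2"]) (auto simp: vec_eq_iff A_def S_def)
qed

section \<open>From the covariance to the graph\<close>

lemma congruent_scalar_imp_inverse:
  fixes A S :: "real^'n^'n"
  assumes "s > 0" and "A ** S ** transpose A = s *\<^sub>R mat 1"
  shows "S ** (inverse s *\<^sub>R (transpose A ** A)) = mat 1"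
proof -
  have "A ** (inverse s *\<^sub>R (S ** transpose A)) = inverse s *\<^sub>R (A ** S ** transpose A)"
    by (simp add: matrix_mul_assoc scalar_matrix_assoc matrix_scalar_ac)
  also have "\<dots> = mat 1"
    using assms by simp
  \<comment> \<open>For square matrices a right inverse is a left inverse; this moves
    \<open>A\<close> to the other end of the product.\<close>
  finally have "(inverse s *\<^sub>R (S ** transpose A)) ** A = mat 1"
    by (simp add: matrix_left_right_inverse)
  then show ?thesis
    by (simp add: matrix_mul_assoc scalar_matrix_assoc matrix_scalar_ac)
qed

theorem proposition4p2:
  fixes M :: "'w measure" and M' :: "'v measure"
    and B B' :: "real^'n^'n"
    and V Z :: "'w \<Rightarrow> real^'d^'n"
    and V' Z' :: "'v \<Rightarrow> real^'d^'n"
  assumes "normalized_sem M B V"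
    and "generated_by M B V Z"
    and "normalized_sem M' B' V'"
    and "generated_by M' B' V' Z'"
    and "distr M' borel Z' = distr M borel Z"
  shows "sem_graph B' = sem_graph B"
proof -
  define S where "S = row_covariance (distr M borel Z)"
  obtain s where s: "s > 0" "(mat 1 - B) ** S ** transpose (mat 1 - B) = s *\<^sub>R mat 1"
    using sem_row_covariance[OF assms(1,2)] unfolding S_def by blast
  obtain s' where s': "s' > 0" "(mat 1 - B') ** S ** transpose (mat 1 - B') = s' *\<^sub>R mat 1"
    \<comment> \<open>Equality of the laws lets the same \<open>S\<close> serve the second model,
      which may live on another sample space.\<close>
    using sem_row_covariance[OF assms(3,4)] unfolding S_def assms(5) by blast
  have "inverse s *\<^sub>R (transpose (mat 1 - B) ** (mat 1 - B))
      = inverse s' *\<^sub>R (transpose (mat 1 - B') ** (mat 1 - B'))" (is "?T = ?T'")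
  proof -
    \<comment> \<open>A right and a left inverse of the same matrix coincide.\<close>
    have "S ** ?T = mat 1" "?T' ** S = mat 1"
      using congruent_scalar_imp_inverse[OF s] congruent_scalar_imp_inverse[OF s']
      by (simp_all add: matrix_left_right_inverse)
    then show ?thesis
      by (metis matrix_mul_assoc matrix_mul_lid matrix_mul_rid)
  qed
  then have "B = B'"
    using assms(1,3) s(1) s'(1)
    by (intro acyclic_gram_inject[of B B' "inverse s" "inverse s'"]) (auto simp: normalized_sem_def)
  then show ?thesis
    by simp
qed

end
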